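(* If $X\in 2^\omega$ is complex and proper, then there is a computable, continuous measure $\nu$ on $2^\omega$ such that $X$ is Martin-Löf random with respect to $\nu$.
   Context: All measures are Borel probability measures on Cantor space $2^\omega$. For a finite binary string $\sigma\in 2^{<\omega}$ write $\mu(\sigma)$ for $\mu(\{X\in 2^\omega : \sigma\prec X\})$. A measure $\mu$ is computable if $\sigma\mapsto\mu(\sigma)$ is a computable real-valued function. A measure $\mu$ is continuous if $\mu(\{X\})=0$ for all $X\in 2^\omega$. A $\mu$-Martin-Löf test is a uniformly $\Sigma^0_1$ sequence $(\mathcal U_i)_{i\in\omega}$ with $\mu(\mathcal U_i)\le 2^{-i}$; $X$ is $\mu$-Martin-Löf random if $X\notin\bigcap_i\mathcal U_i$ for every such test. $X$ is proper if it is $\mu$-Martin-Löf random for some computable measure $\mu$ (possibly with atoms). $X\upharpoonright n$ denotes the initial segment of $X$ of length $n$. $\mathrm K$ is prefix-free Kolmogorov complexity. An order is a non-decreasing unbounded function $f:\omega\to\omega$ with $f(0)=0$. $X\in 2^\omega$ is complex if there is a computable order $f$ such that $\mathrm K(X\upharpoonright n)\ge f(n)$ for all $n$. *)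

theory Defs
  imports
    "HOL-Probability.Probability_Measure"
    "HOL-Library.Extended_Nat"
    "HOL-Library.Sublist"
begin

section \<open>Partial recursive functions\<close>

text \<open>
  Kleene's schemes (composition, primitive recursion, minimization), evaluated on argument lists.
  The arity is implicit in the length of the argument list; \<^term>\<open>None\<close> means divergence.
\<close>

datatype recf =
    Zero
  | Succ
  | Proj nat
  | Comp recf "recf list"
  | PrimRec recf recf
  | Mu recf

text \<open>
  In \<open>PrimRec\<close> and \<open>Mu\<close> the first argument is the recursion variable, respectively the search
  variable. As usual, \<open>Mu f\<close> diverges as soon as \<open>f\<close> diverges below the first zero.
\<close>

primrec eval :: "recf \<Rightarrow> nat list \<Rightarrow> nat option" where
  "eval Zero xs = Some 0"
| "eval Succ xs = (case xs of [] \<Rightarrow> None | x # _ \<Rightarrow> Some (Suc x))"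
| "eval (Proj i) xs = (if i < length xs then Some (xs ! i) else None)"
| "eval (Comp f gs) xs =
    (let ys = map (\<lambda>e. e xs) (map eval gs)
     in if None \<in> set ys then None else eval f (map the ys))"
| "eval (PrimRec f g) xs =
    (case xs of
       [] \<Rightarrow> None
     | x # ys \<Rightarrow> rec_nat (eval f ys) (\<lambda>n r. Option.bind r (\<lambda>v. eval g (n # v # ys))) x)"
| "eval (Mu f) xs =
    (if \<exists>n. eval f (n # xs) = Some 0 \<and> (\<forall>m<n. eval f (m # xs) \<noteq> None)
     then Some (LEAST n. eval f (n # xs) = Some 0) else None)"

definition partial_computable :: "(nat \<Rightarrow> nat option) \<Rightarrow> bool" where
  "partial_computable f \<longleftrightarrow> (\<exists>c. \<forall>x. eval c [x] = f x)"

definition computable1 :: "(nat \<Rightarrow> nat) \<Rightarrow> bool" where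
  "computable1 f \<longleftrightarrow> (\<exists>c. \<forall>x. eval c [x] = Some (f x))"

definition computable2 :: "(nat \<Rightarrow> nat \<Rightarrow> nat) \<Rightarrow> bool" where
  "computable2 f \<longleftrightarrow> (\<exists>c. \<forall>x y. eval c [x, y] = Some (f x y))"

definition decidable3 :: "(nat \<Rightarrow> nat \<Rightarrow> nat \<Rightarrow> bool) \<Rightarrow> bool" where
  "decidable3 R \<longleftrightarrow> (\<exists>c. \<forall>x y z. eval c [x, y, z] = Some (of_bool (R x y z)))"


section \<open>Binary strings and Cantor space\<close>

text \<open>
  Strings are coded by the bijective base-2 numeration (least significant digit first), with
  \<^term>\<open>False\<close> as digit 1 and \<^term>\<open>True\<close> as digit 2. Computability on strings is computability
  on codes.
\<close>

primrec str_code :: "bool list \<Rightarrow> nat" where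
  "str_code [] = 0"
| "str_code (b # s) = 2 * str_code s + (if b then 2 else 1)"

lemma bij_str_code: "bij str_code"
proof (rule bijI)
  have "str_code s = str_code t \<Longrightarrow> s = t" for s t
  proof (induction s arbitrary: t)
    case Nil
    then show ?case by (cases t) (auto split: if_splits)
  next
    case (Cons a s)
    then obtain b t' where t: "t = b # t'"
      by (cases t) (auto split: if_splits)
    have "2 * str_code s + (if a then 2 else 1) = 2 * str_code t' + (if b then 2 else 1)"
      using Cons.prems t by simp
    then have "a = b \<and> str_code s = str_code t'"
      by (cases a; cases b) (simp_all, presburger+)
    then show ?case using Cons.IH t by auto
  qed
  then show "inj str_code" by (auto intro: injI)
  have "\<exists>s. str_code s = n" for n
  proof (induction n rule: less_induct)
    case (less n)
    show ?case
    proof (cases "n = 0")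
      case True
      then show ?thesis by (intro exI[of _ "[]"]) simp
    next
      case False
      define b where "b = even n"
      have "(n - (if b then 2 else 1)) div 2 < n" using False by auto
      then obtain s where "str_code s = (n - (if b then 2 else 1)) div 2"
        using less by blast
      then have "str_code (b # s) = n"
        using False by (auto simp: b_def elim!: evenE oddE)
      then show ?thesis by blast
    qed
  qed
  then show "surj str_code" by (metis surjI)
qed

type_synonym cantor = "nat \<Rightarrow> bool"

definition init :: "cantor \<Rightarrow> nat \<Rightarrow> bool list" where
  "init X n = map X [0..<n]"

definition cyl :: "bool list \<Rightarrow> cantor set" where
  "cyl s = {X. init X (length s) = s}"


section \<open>Computable measures and Martin-Loef randomness\<close>

text \<open>The topology on \<^typ>\<open>cantor\<close> is the product of the discrete topologies on \<^typ>\<open>bool\<close>.\<close>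

definition cantor_measure :: "cantor measure \<Rightarrow> bool" where
  "cantor_measure \<mu> \<longleftrightarrow> prob_space \<mu> \<and> sets \<mu> = sets borel"

text \<open>
  \<open>F\<close> is computable if a rational approximation of \<open>F s\<close> up to an error of \<open>2\<^sup>-\<^sup>n\<close> can be computed
  uniformly in \<open>s\<close> and \<open>n\<close>; here the rational is given as \<open>(a - b) / (d + 1)\<close>.
\<close>

definition computable_real_fun :: "(bool list \<Rightarrow> real) \<Rightarrow> bool" where
  "computable_real_fun F \<longleftrightarrow>
    (\<exists>a b d. computable2 a \<and> computable2 b \<and> computable2 d \<and>
      (\<forall>s n. \<bar>F s - (real (a (str_code s) n) - real (b (str_code s) n))
                      / real (Suc (d (str_code s) n))\<bar> \<le> 1 / 2 ^ n))"

definition computable_measure :: "cantor measure \<Rightarrow> bool" where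
  "computable_measure \<mu> \<longleftrightarrow>
    cantor_measure \<mu> \<and> computable_real_fun (\<lambda>s. measure \<mu> (cyl s))"

definition continuous_measure :: "cantor measure \<Rightarrow> bool" where
  "continuous_measure \<mu> \<longleftrightarrow> (\<forall>X. measure \<mu> {X} = 0)"

text \<open>
  \<open>U i\<close> is the open set generated by the \<open>i\<close>-th section of a c.e. set of pairs \<open>(i, s)\<close>, where c.e.
  sets are projections of decidable relations.
\<close>

definition uniformly_Sigma01 :: "(nat \<Rightarrow> cantor set) \<Rightarrow> bool" where
  "uniformly_Sigma01 U \<longleftrightarrow>
    (\<exists>R. decidable3 R \<and> (\<forall>i. U i = (\<Union>s\<in>{s. \<exists>k. R i (str_code s) k}. cyl s)))"

definition ml_test :: "cantor measure \<Rightarrow> (nat \<Rightarrow> cantor set) \<Rightarrow> bool" where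
  "ml_test \<mu> U \<longleftrightarrow> uniformly_Sigma01 U \<and> (\<forall>i. measure \<mu> (U i) \<le> 1 / 2 ^ i)"

definition ml_random :: "cantor measure \<Rightarrow> cantor \<Rightarrow> bool" where
  "ml_random \<mu> X \<longleftrightarrow> (\<forall>U. ml_test \<mu> U \<longrightarrow> X \<notin> (\<Inter>i. U i))"

definition proper_seq :: "cantor \<Rightarrow> bool" where
  "proper_seq X \<longleftrightarrow> (\<exists>\<mu>. computable_measure \<mu> \<and> ml_random \<mu> X)"


section \<open>Prefix-free Kolmogorov complexity\<close>

type_synonym machine = "bool list \<Rightarrow> bool list option"

definition prefix_free_machine :: "machine \<Rightarrow> bool" where
  "prefix_free_machine M \<longleftrightarrow>
    (\<exists>f. partial_computable f \<and> (\<forall>p. f (str_code p) = map_option str_code (M p))) \<and>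
    (\<forall>p\<in>dom M. \<forall>q\<in>dom M. prefix p q \<longrightarrow> p = q)"

text \<open>The infimum is \<open>\<infinity>\<close> if \<open>s\<close> is not an output of \<open>M\<close>.\<close>

definition KM :: "machine \<Rightarrow> bool list \<Rightarrow> enat" where
  "KM M s = (INF p\<in>{p. M p = Some s}. enat (length p))"

text \<open>
  Prefix-free complexity \<open>K\<close> is \<^term>\<open>KM U\<close> for a universal prefix-free machine \<open>U\<close>, where
  universality is meant in the weak sense of optimality up to an additive constant.
\<close>

definition universal_machine :: "machine \<Rightarrow> bool" where
  "universal_machine U \<longleftrightarrow> prefix_free_machine U \<and>
    (\<forall>M. prefix_free_machine M \<longrightarrow> (\<exists>c. \<forall>s. KM U s \<le> KM M s + enat c))"

definition order_fun :: "(nat \<Rightarrow> nat) \<Rightarrow> bool" where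
  "order_fun f \<longleftrightarrow> mono f \<and> (\<forall>m. \<exists>n. m \<le> f n) \<and> f 0 = 0"

definition complex_seq :: "machine \<Rightarrow> cantor \<Rightarrow> bool" where
  "complex_seq U X \<longleftrightarrow>
    (\<exists>f. computable1 f \<and> order_fun f \<and> (\<forall>n. enat (f n) \<le> KM U (init X n)))"

end

theory Submission
  imports Defs "HOL-Probability.Infinite_Product_Measure"
begin

text \<open>
  Let \<open>X\<close> be random for the computable measure \<open>\<mu>\<close>, and let \<open>f\<close> be a computable order below the
  complexity of the initial segments of \<open>X\<close>. The measure \<open>\<mu>\<close> may have atoms, but complexity keeps \<open>X\<close>
  away from them. Put \<open>g = f div 3\<close>, and let \<open>n\<close> be a length at which \<open>g\<close> takes a value \<open>k\<close> larger than
  all its earlier values. A string of this length is called heavy if a rational approximation of its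
  \<open>\<mu>\<close>-measure shows that this measure exceeds \<open>2\<^sup>-\<^sup>k\<close>. As the length is determined by \<open>k\<close>, at most
  \<open>2\<^sup>k\<close> strings are heavy for \<open>k\<close>, and a prefix-free machine can describe each of them by \<open>k\<close>
  in unary followed by an index of \<open>k\<close> bits (\<open>KM_le_of_few\<close>). Hence heavy strings have complexity at most
  \<open>2 k + c\<close>, whereas the initial segments of \<open>X\<close> have complexity at least \<open>3 k\<close>: no initial
  segment of \<open>X\<close> is heavy for a \<open>k\<close> above \<open>c\<close>.

  Being heavy is decidable, so \<open>\<mu>\<close> can be modified effectively: \<open>\<nu>\<close> follows \<open>\<mu>\<close> until a heavy string
  with \<open>k > c\<close> appears and tosses a fair coin from there on. Formally, \<open>\<nu>\<close> is the image of the product of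
  \<open>\<mu>\<close> with the fair coin measure under a splicing map. Its values on cylinders are values of \<open>\<mu>\<close> divided by
  explicit powers of two (\<open>measure_spliced_cyl\<close>), so \<open>\<nu>\<close> is computable. It is continuous: along a sequence
  without such heavy prefixes the \<open>\<mu>\<close>-measures of the prefixes tend to \<open>0\<close>, and along any other
  sequence the measure is eventually halved with each bit. Finally, \<open>\<mu>\<close> and \<open>\<nu>\<close> agree where no coin is
  tossed, so a \<open>\<nu>\<close>-test that captures \<open>X\<close> becomes a \<open>\<mu>\<close>-test that captures \<open>X\<close> when only the cylinders
  without heavy prefixes are kept (\<open>ml_random_spliced\<close>).
\<close>

section \<open>Total recursive functions\<close>

text \<open>
  The arguments are collected in an environment \<open>e\<close>, of which only the first \<open>n\<close> entries are passed to
  the program. Variables are de Bruijn indices: under a binder the old environment is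
  \<open>\<lambda>i. e (Suc i)\<close>, and the bound variable is \<open>e 0\<close>. In this form, the closure properties below can be
  applied as introduction rules that follow the structure of a term.
\<close>

definition recursive_in :: "nat \<Rightarrow> ((nat \<Rightarrow> nat) \<Rightarrow> nat) \<Rightarrow> bool" where
  "recursive_in n F \<longleftrightarrow> (\<exists>c. \<forall>e. eval c (map e [0..<n]) = Some (F e))"

text \<open>
  Substitution covers composition as well as renaming, duplicating and dropping variables; the remaining
  closure properties come from this and primitive recursion.
\<close>

lemma recursive_in_subst:
  assumes F: "recursive_in m F" and A: "\<And>i. i < m \<Longrightarrow> recursive_in n (A i)"
  shows "recursive_in n (\<lambda>e. F (\<lambda>i. A i e))"
proof -
  obtain c where c: "\<And>e. eval c (map e [0..<m]) = Some (F e)"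
    using F by (auto simp: recursive_in_def)
  have "\<forall>i. \<exists>d. i < m \<longrightarrow> (\<forall>e. eval d (map e [0..<n]) = Some (A i e))"
    using A by (auto simp: recursive_in_def)
  then obtain d where d: "\<And>i e. i < m \<Longrightarrow> eval (d i) (map e [0..<n]) = Some (A i e)"
    by metis
  have "eval (Comp c (map d [0..<m])) (map e [0..<n]) = Some (F (\<lambda>i. A i e))" for e
  proof -
    have "map (\<lambda>h. h (map e [0..<n])) (map eval (map d [0..<m])) = map (\<lambda>i. Some (A i e)) [0..<m]"
      using d by simp
    moreover have "None \<notin> set (map (\<lambda>i. Some (A i e)) [0..<m])" by auto
    ultimately show ?thesis
      using c[of "\<lambda>i. A i e"] by (simp only: eval.simps Let_def if_False map_map comp_def option.sel)
  qed
  then show ?thesis unfolding recursive_in_def by blast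
qed

lemma recursive_in_primrec:
  assumes "recursive_in n B" "recursive_in (Suc (Suc n)) S"
  shows "recursive_in (Suc n) (\<lambda>e. rec_nat (B (\<lambda>i. e (Suc i)))
    (\<lambda>k r. S (case_nat k (case_nat r (\<lambda>i. e (Suc i))))) (e 0))"
proof -
  obtain b where b: "\<And>e. eval b (map e [0..<n]) = Some (B e)"
    using assms by (auto simp: recursive_in_def)
  obtain s where s: "\<And>e. eval s (map e [0..<Suc (Suc n)]) = Some (S e)"
    using assms by (auto simp only: recursive_in_def)
  have s': "eval s (k # r # map e [0..<n]) = Some (S (case_nat k (case_nat r e)))" for k r e
    using s[of "case_nat k (case_nat r e)"] by (simp add: map_upt_Suc del: upt_Suc)
  have "rec_nat (Some (B e)) (\<lambda>n' r. Option.bind r (\<lambda>v. eval s (n' # v # map e [0..<n]))) x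
      = Some (rec_nat (B e) (\<lambda>k r. S (case_nat k (case_nat r e))) x)" for e x
    by (induction x) (auto simp: s')
  then have "eval (PrimRec b s) (map e [0..<Suc n]) = Some (rec_nat (B (\<lambda>i. e (Suc i)))
    (\<lambda>k r. S (case_nat k (case_nat r (\<lambda>i. e (Suc i))))) (e 0))" for e
    by (simp add: map_upt_Suc b del: upt_Suc)
  then show ?thesis unfolding recursive_in_def by blast
qed

named_theorems rec_intro

lemma recursive_in_var [rec_intro]: "i < n \<Longrightarrow> recursive_in n (\<lambda>e. e i)"
  unfolding recursive_in_def by (rule exI[of _ "Proj i"]) simp

lemma recursive_in_Suc [rec_intro]:
  assumes "recursive_in n A" shows "recursive_in n (\<lambda>e. Suc (A e))"
proof -
  have "recursive_in 1 (\<lambda>e. Suc (e 0))"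
    unfolding recursive_in_def by (rule exI[of _ Succ]) simp
  from recursive_in_subst[OF this, of n "\<lambda>_. A"] assms show ?thesis by simp
qed

lemma recursive_in_const [rec_intro]: "recursive_in n (\<lambda>_. k)"
proof (induction k)
  case 0
  show ?case unfolding recursive_in_def by (rule exI[of _ Zero]) simp
qed (rule recursive_in_Suc)

lemma recursive_in_1: "recursive_in 1 (\<lambda>e. f (e 0)) \<longleftrightarrow> computable1 f"
proof -
  have "(\<forall>e. eval c (map e [0..<1]) = Some (f (e 0))) \<longleftrightarrow> (\<forall>x. eval c [x] = Some (f x))" for c
  proof (intro iffI allI)
    fix x assume a: "\<forall>e. eval c (map e [0..<1]) = Some (f (e 0))"
    show "eval c [x] = Some (f x)" using a[rule_format, of "\<lambda>_. x"] by simp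
  qed simp
  then show ?thesis unfolding recursive_in_def computable1_def by simp
qed

lemma recursive_in_2: "recursive_in 2 (\<lambda>e. f (e 0) (e 1)) \<longleftrightarrow> computable2 f"
proof -
  have "(\<forall>e. eval c (map e [0..<2]) = Some (f (e 0) (e 1))) \<longleftrightarrow>
      (\<forall>x y. eval c [x, y] = Some (f x y))" for c
  proof (intro iffI allI)
    fix x y assume a: "\<forall>e. eval c (map e [0..<2]) = Some (f (e 0) (e 1))"
    show "eval c [x, y] = Some (f x y)"
      using a[rule_format, of "case_nat x (\<lambda>_. y)"] by (simp add: numeral_2_eq_2)
  qed (simp add: numeral_2_eq_2)
  then show ?thesis unfolding recursive_in_def computable2_def by simp
qed

lemma recursive_in_3:
  "recursive_in 3 (\<lambda>e. of_bool (R (e 0) (e 1) (e 2))) \<longleftrightarrow> decidable3 R"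
proof -
  have "(\<forall>e. eval c (map e [0..<3]) = Some (of_bool (R (e 0) (e 1) (e 2)))) \<longleftrightarrow>
      (\<forall>x y z. eval c [x, y, z] = Some (of_bool (R x y z)))" for c
  proof (intro iffI allI)
    fix x y z assume a: "\<forall>e. eval c (map e [0..<3]) = Some (of_bool (R (e 0) (e 1) (e 2)))"
    show "eval c [x, y, z] = Some (of_bool (R x y z))"
      using a[rule_format, of "case_nat x (case_nat y (\<lambda>_. z))"]
      by (simp add: numeral_3_eq_3 numeral_2_eq_2)
  qed (simp add: numeral_3_eq_3 numeral_2_eq_2)
  then show ?thesis unfolding recursive_in_def decidable3_def by simp
qed

text \<open>
  The closure under an already known computable function is not an introduction rule: with a schematic
  function its conclusion would match every goal. It is used only with that function given.
\<close>

lemma recursive_in_comp1: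
  assumes "computable1 f" "recursive_in n A" shows "recursive_in n (\<lambda>e. f (A e))"
  using recursive_in_subst[OF assms(1)[folded recursive_in_1], of n "\<lambda>_. A"] assms(2) by simp

lemma recursive_in_comp2:
  assumes "computable2 f" "recursive_in n A" "recursive_in n B"
  shows "recursive_in n (\<lambda>e. f (A e) (B e))"
  using recursive_in_subst[OF assms(1)[folded recursive_in_2], of n "case_nat A (\<lambda>_. B)"] assms(2,3)
  by (simp add: less_2_cases_iff split: nat.splits)

lemma recursive_in_comp3:
  assumes "decidable3 R" "recursive_in n A" "recursive_in n B" "recursive_in n C"
  shows "recursive_in n (\<lambda>e. of_bool (R (A e) (B e) (C e)))"
proof -
  have "recursive_in n (case_nat A (case_nat B (\<lambda>_. C)) i)" for i
    using assms(2-4) by (simp split: nat.splits)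
  from recursive_in_subst[OF assms(1)[folded recursive_in_3], of n "case_nat A (case_nat B (\<lambda>_. C))", OF this]
  show ?thesis by (simp add: numeral_2_eq_2)
qed

lemma recursive_in_weaken:
  assumes "recursive_in n A" shows "recursive_in (Suc n) (\<lambda>e. A (\<lambda>i. e (Suc i)))"
  using recursive_in_subst[OF assms, of "Suc n" "\<lambda>i e. e (Suc i)"] by (simp add: recursive_in_var)

lemma recursive_in_rec [rec_intro]:
  assumes "recursive_in n A" "recursive_in n B"
    and S: "recursive_in (Suc (Suc n)) (\<lambda>e. S (e 0) (e (Suc 0)) (\<lambda>i. e (Suc (Suc i))))"
  shows "recursive_in n (\<lambda>e. rec_nat (B e) (\<lambda>k r. S k r e) (A e))"
proof -
  have "recursive_in n (case_nat A (\<lambda>i e. e i) i)" if "i < Suc n" for i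
    using assms(1) that by (auto split: nat.splits intro: recursive_in_var)
  from recursive_in_subst[where A = "case_nat A (\<lambda>i e. e i)", OF recursive_in_primrec[OF assms(2) S] this]
  show ?thesis by simp
qed

lemma recursive_in_pred: 
  assumes "recursive_in n A" shows "recursive_in n (\<lambda>e. A e - 1)"
proof -
  have "a - 1 = rec_nat 0 (\<lambda>k r. k) a" for a :: nat by (cases a) auto
  then show ?thesis by (simp only:) (intro rec_intro assms; simp)
qed

lemma recursive_in_add [rec_intro]:
  assumes "recursive_in n A" "recursive_in n B" shows "recursive_in n (\<lambda>e. A e + B e)"
proof -
  have "a + b = rec_nat b (\<lambda>k r. Suc r) a" for a b :: nat by (induction a) auto
  then show ?thesis by (simp only:) (intro rec_intro assms; simp)
qed

lemma recursive_in_diff [rec_intro]: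
  assumes "recursive_in n A" "recursive_in n B" shows "recursive_in n (\<lambda>e. A e - B e)"
proof -
  have "a - b = rec_nat a (\<lambda>k r. r - 1) b" for a b :: nat by (induction b) auto
  then have eq: "(\<lambda>e. A e - B e) = (\<lambda>e. rec_nat (A e) (\<lambda>k r. r - 1) (B e))" by blast
  show ?thesis unfolding eq by (intro rec_intro recursive_in_pred assms; simp)
qed

text \<open>
  Bounded sums take over the role of bounded search: they count, they express bounded quantifiers,
  division and string length, and they compute least witnesses of monotone properties.
\<close>

lemma recursive_in_sum [rec_intro]:
  assumes "recursive_in n A" "recursive_in (Suc n) (\<lambda>e. F (e 0) (\<lambda>i. e (Suc i)))"
  shows "recursive_in n (\<lambda>e. \<Sum>z<A e. F z e)"
proof -
  have eq: "(\<Sum>z<a. F z e) = rec_nat 0 (\<lambda>k r. r + F k e) a" for a e by (induction a) auto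
  have "recursive_in (Suc (Suc n)) (case_nat (\<lambda>e. e 0) (\<lambda>i e. e (Suc (Suc i))) i)" if "i < Suc n" for i
    using that by (auto split: nat.splits intro!: rec_intro)
  from recursive_in_subst[where A = "case_nat (\<lambda>e. e 0) (\<lambda>i e. e (Suc (Suc i)))", OF assms(2) this]
  have "recursive_in (Suc (Suc n)) (\<lambda>e. F (e 0) (\<lambda>i. e (Suc (Suc i))))" by simp
  then show ?thesis unfolding eq by (intro rec_intro assms; simp)
qed

lemma recursive_in_mult [rec_intro]:
  assumes "recursive_in n A" "recursive_in n B" shows "recursive_in n (\<lambda>e. A e * B e)"
proof -
  have "a * b = rec_nat 0 (\<lambda>k r. r + b) a" for a b :: nat by (induction a) auto
  moreover have "recursive_in (Suc (Suc n)) (\<lambda>e. B (\<lambda>i. e (Suc (Suc i))))"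
    using recursive_in_subst[OF assms(2), of "Suc (Suc n)" "\<lambda>i e. e (Suc (Suc i))"]
    by (simp add: recursive_in_var)
  ultimately show ?thesis by (simp only:) (intro rec_intro assms; simp)
qed

lemma recursive_in_pow2 [rec_intro]:
  assumes "recursive_in n A" shows "recursive_in n (\<lambda>e. 2 ^ A e)"
proof -
  have "2 ^ a = (rec_nat 1 (\<lambda>k r. r + r) a :: nat)" for a by (induction a) auto
  then show ?thesis by (simp only:) (intro rec_intro assms; simp)
qed

lemma recursive_in_le [rec_intro]:
  assumes "recursive_in n A" "recursive_in n B" shows "recursive_in n (\<lambda>e. of_bool (A e \<le> B e))"
proof -
  have "of_bool (a \<le> b) = 1 - (a - b)" for a b :: nat by auto
  then show ?thesis by (simp only:) (intro rec_intro assms)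
qed

lemma recursive_in_not [rec_intro]:
  assumes "recursive_in n (\<lambda>e. of_bool (P e))" shows "recursive_in n (\<lambda>e. of_bool (\<not> P e))"
proof -
  have "of_bool (\<not> p) = 1 - (of_bool p :: nat)" for p by simp
  then show ?thesis by (simp only:) (intro rec_intro assms)
qed

lemma recursive_in_conj [rec_intro]:
  assumes "recursive_in n (\<lambda>e. of_bool (P e))" "recursive_in n (\<lambda>e. of_bool (Q e))"
  shows "recursive_in n (\<lambda>e. of_bool (P e \<and> Q e))"
  unfolding of_bool_conj by (intro rec_intro assms)

lemma recursive_in_less [rec_intro]:
  assumes "recursive_in n A" "recursive_in n B" shows "recursive_in n (\<lambda>e. of_bool (A e < B e))"
  unfolding less_eq_Suc_le by (intro rec_intro assms)

lemma recursive_in_eq [rec_intro]: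
  assumes "recursive_in n A" "recursive_in n B" shows "recursive_in n (\<lambda>e. of_bool (A e = B e))"
  unfolding eq_iff by (intro rec_intro assms)

lemma recursive_in_ex [rec_intro]:
  assumes "recursive_in n A" "recursive_in (Suc n) (\<lambda>e. of_bool (P (e 0) (\<lambda>i. e (Suc i))))"
  shows "recursive_in n (\<lambda>e. of_bool (\<exists>z<A e. P z e))"
proof -
  have "(\<exists>z<a. P z e) \<longleftrightarrow> 0 < (\<Sum>z<a. of_bool (P z e) :: nat)" for a e
    by (simp add: card_gt_0_iff) blast
  then show ?thesis by (simp only:) (intro rec_intro assms)
qed

lemma recursive_in_div [rec_intro]:
  assumes "recursive_in n A" "recursive_in n B"
  shows "recursive_in n (\<lambda>e. A e div B e)"
proof -
  have "a div b = of_bool (0 < b) * (\<Sum>z<a. of_bool (Suc z * b \<le> a))" for a b :: nat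
  proof (cases "b = 0")
    case False
    have "Suc z * b \<le> a \<longleftrightarrow> z < a div b" for z
      using False by (simp add: less_eq_div_iff_mult_less_eq flip: Suc_le_eq)
    then have "{..<a} \<inter> {z. Suc z * b \<le> a} = {..<a div b}"
      by (auto simp del: mult_Suc intro: less_le_trans[OF _ div_le_dividend])
    then show ?thesis using False by (simp del: mult_Suc)
  qed simp
  then show ?thesis
    by (simp only:) (intro rec_intro assms assms[THEN recursive_in_weaken]; simp)
qed

lemma recursive_in_mod [rec_intro]:
  assumes "recursive_in n A" "recursive_in n B"
  shows "recursive_in n (\<lambda>e. A e mod B e)"
  unfolding minus_mult_div_eq_mod[symmetric] by (intro rec_intro assms)

section \<open>Computing with codes of strings\<close>

abbreviation decode :: "nat \<Rightarrow> bool list" where "decode \<equiv> inv str_code"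

lemma decode_str_code [simp]: "decode (str_code s) = s"
  using bij_str_code by (simp add: bij_is_inj)

lemma str_code_decode [simp]: "str_code (decode x) = x"
  using bij_str_code by (simp add: bij_is_surj surj_f_inv_f)

lemma str_code_eq_iff [simp]: "str_code s = str_code t \<longleftrightarrow> s = t"
  by (metis decode_str_code)

lemma str_code_bounds: "2 ^ length s \<le> Suc (str_code s)" "Suc (str_code s) < 2 * 2 ^ length s"
  by (induction s) auto

text \<open>
  In binary notation, \<open>Suc (str_code s)\<close> is a leading one followed by the bits of \<open>s\<close>, with the head of
  \<open>s\<close> as the least significant bit. So lengths are binary logarithms, and taking prefixes amounts to
  reducing modulo powers of two.
\<close>

lemma less_length_iff: "i < length s \<longleftrightarrow> 2 ^ Suc i \<le> Suc (str_code s)"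
proof
  assume "i < length s"
  then have "(2::nat) ^ Suc i \<le> 2 ^ length s" by (intro power_increasing) auto
  then show "2 ^ Suc i \<le> Suc (str_code s)" using str_code_bounds(1) le_trans by blast
next
  assume "2 ^ Suc i \<le> Suc (str_code s)"
  then have "(2::nat) ^ Suc i < 2 ^ Suc (length s)" using str_code_bounds(2)[of s] unfolding power_Suc by linarith
  then have "Suc i < Suc (length s)" by (rule power_less_imp_less_exp[rotated]) simp
  then show "i < length s" by simp
qed

lemma length_decode: "length (decode x) = (\<Sum>i<x. of_bool (2 ^ Suc i \<le> Suc x))"
proof -
  have "i < x" if "i < length (decode x)" for i
    using that less_exp[of "Suc i"] less_length_iff[of i "decode x"] by simp
  then have "{..<x} \<inter> {i. 2 ^ Suc i \<le> Suc x} = {..<length (decode x)}"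
    using less_length_iff[of _ "decode x"] by auto
  then show ?thesis by (simp del: power_Suc)
qed

lemma str_code_take:
  "m \<le> length s \<Longrightarrow> Suc (str_code (take m s)) = 2 ^ m + Suc (str_code s) mod 2 ^ m"
proof (induction s arbitrary: m)
  case (Cons b s)
  have mod: "(2 * c + of_bool b) mod (2 * 2 ^ n) = 2 * (c mod 2 ^ n) + of_bool b" for c n :: nat
    by (cases b) (simp_all add: mod_mult2_eq)
  show ?case
  proof (cases m)
    case (Suc n)
    then have "Suc (str_code (take n s)) = 2 ^ n + Suc (str_code s) mod 2 ^ n"
      using Cons by simp
    moreover have "Suc (str_code (b # s)) = 2 * Suc (str_code s) + of_bool b" for s by simp
    ultimately show ?thesis unfolding Suc by (simp only: mod take_Suc_Cons power_Suc add_mult_distrib2 add.assoc)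
  qed simp
qed simp

lemma recursive_in_length [rec_intro]:
  assumes "recursive_in n A" shows "recursive_in n (\<lambda>e. length (decode (A e)))"
  unfolding length_decode by (intro rec_intro assms assms[THEN recursive_in_weaken]; simp)

text \<open>
  Monus expresses \<open>min m (length s)\<close> as \<open>length s - (length s - m)\<close>.
\<close>

lemma recursive_in_take [rec_intro]:
  assumes "recursive_in n A" "recursive_in n B"
  shows "recursive_in n (\<lambda>e. str_code (take (A e) (decode (B e))))"
proof -
  have "str_code (take m s) =
      (let k = length s - (length s - m) in 2 ^ k + Suc (str_code s) mod 2 ^ k - 1)" for m s
    using str_code_take[of "min m (length s)" s] by (cases "m \<le> length s") (auto simp: Let_def)
  then have *: "str_code (take m (decode x)) =
      2 ^ (length (decode x) - (length (decode x) - m)) +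
      Suc x mod 2 ^ (length (decode x) - (length (decode x) - m)) - 1" for m x
    by (simp add: Let_def)
  show ?thesis unfolding * by (intro rec_intro assms)
qed

text \<open>
  The length must be exactly \<open>k\<close>: a prefix-free code needs indices of a length known in advance.
\<close>

lemma ex_string_of_length:
  assumes "r < 2 ^ k" shows "\<exists>q. length q = k \<and> Suc (str_code q) = 2 ^ k + r"
proof -
  define q where "q = decode (2 ^ k + r - 1)"
  have q: "Suc (str_code q) = 2 ^ k + r"
    unfolding q_def by (simp add: Suc_diff_Suc)
  have "i < length q \<longleftrightarrow> i < k" for i
  proof -
    have "2 ^ Suc i \<le> 2 ^ k + r \<longleftrightarrow> i < k"
    proof
      assume "2 ^ Suc i \<le> 2 ^ k + r"
      then have "(2::nat) ^ Suc i < 2 ^ Suc k" using assms unfolding power_Suc by linarith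
      then have "Suc i < Suc k" by (rule power_less_imp_less_exp[rotated]) simp
      then show "i < k" by simp
    next
      assume "i < k"
      then have "(2::nat) ^ Suc i \<le> 2 ^ k" by (intro power_increasing) auto
      then show "2 ^ Suc i \<le> 2 ^ k + r" by simp
    qed
    then show ?thesis unfolding less_length_iff q .
  qed
  then have "length q = k" by (meson linorder_neqE_nat less_irrefl)
  with q show ?thesis by blast
qed

section \<open>Strings in small decidable classes have low complexity\<close>

text \<open>
  A block of \<open>k\<close> ones acts on \<open>str_code s + 2\<close> as multiplication by \<open>2\<^sup>k\<close>. Hence the code of a
  self-delimiting word is given by an arithmetical formula, and no string operations have to be
  programmed for the machine below.
\<close>

lemma str_code_replicate_True: "str_code (replicate k True @ s) + 2 = 2 ^ k * (str_code s + 2)"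
  by (induction k) auto

lemma prefix_self_delimiting:
  assumes "prefix (replicate k True @ False # q) (replicate k' True @ False # q')"
  shows "k = k'"
  using assms
proof (induction k arbitrary: k')
  case 0
  then show ?case by (cases k') auto
next
  case (Suc k)
  then show ?case by (cases k') auto
qed

lemma recursive_in_count: 
  assumes "computable1 (\<lambda>x. of_bool (Q x))" "computable1 F" "recursive_in n A"
  shows "recursive_in n (\<lambda>e. card {z. z < A e \<and> Q z \<and> F z = F (A e)})"
proof -
  have "card {z. z < y \<and> Q z \<and> F z = F y} = (\<Sum>z<y. of_bool (Q z \<and> F z = F y))" for y
    by (simp add: lessThan_def Collect_conj_eq[symmetric])
  then show ?thesis by (simp only:)
      (intro rec_intro recursive_in_comp1[OF assms(1)] recursive_in_comp1[OF assms(2)]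
        assms(3) assms(3)[THEN recursive_in_weaken]; simp)
qed

text \<open>
  A string \<open>s\<close> in the class \<open>H\<close> with \<open>G s = k\<close> is described by the word \<open>1\<^sup>k 0 q\<close>, where the \<open>k\<close> bits of
  \<open>q\<close> give the position of \<open>s\<close> among the members of \<open>H\<close> with the same value of \<open>G\<close>. The code \<open>P\<close> of this
  word is a total recursive injective function of the code of \<open>s\<close>; the machine is its partial
  inverse, obtained by unbounded search, so it never has to parse its input. The words are prefix-free
  because \<open>k\<close> can be read off from a word and determines its length.
\<close>

lemma KM_le_of_few:
  assumes U: "universal_machine U"
    and H: "computable1 (\<lambda>x. of_bool (H (decode x)))"
    and G: "computable1 (\<lambda>x. G (decode x))"
    and few: "\<And>k. finite {s. H s \<and> G s = k}" "\<And>k. card {s. H s \<and> G s = k} \<le> 2 ^ k"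
  shows "\<exists>c. \<forall>s. H s \<longrightarrow> KM U s \<le> enat (2 * G s + c)"
proof -
  \<comment> \<open>\<open>Q\<close>, \<open>F\<close> and \<open>r\<close> are \<open>H\<close>, \<open>G\<close> and the position, expressed on codes.\<close>
  define Q where "Q y \<longleftrightarrow> H (decode y)" for y
  define F where "F y = G (decode y)" for y
  define r where "r y = card {z. z < y \<and> Q z \<and> F z = F y}" for y
  define P where "P y = 2 ^ F y * (2 * (2 ^ F y + r y) + 1) - 2" for y
  have fin: "finite {z. Q z \<and> F z = k}" and card: "card {z. Q z \<and> F z = k} \<le> 2 ^ k" for k
  proof -
    have bij: "bij_betw str_code {s. H s \<and> G s = k} {z. Q z \<and> F z = k}"
      unfolding bij_betw_def
    proof
      show "inj_on str_code {s. H s \<and> G s = k}" by (simp add: inj_on_def)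
      show "str_code ` {s. H s \<and> G s = k} = {z. Q z \<and> F z = k}"
        by (force simp: Q_def F_def image_iff intro: exI[of _ "decode _"])
    qed
    show "finite {z. Q z \<and> F z = k}" using few(1) bij bij_betw_finite by blast
    show "card {z. Q z \<and> F z = k} \<le> 2 ^ k" using few(2)[of k] bij_betw_same_card[OF bij] by simp
  qed
  have r_mono: "r y < r y'" if "Q y" "y < y'" "F y = F y'" for y y'
    unfolding r_def using that by (intro psubset_card_mono) auto
  have r_bound: "r y < 2 ^ F y" if "Q y" for y
  proof -
    have "r y < card {z. Q z \<and> F z = F y}"
      unfolding r_def using that fin by (intro psubset_card_mono) auto
    then show ?thesis using card[of "F y"] by simp
  qed
  have "\<forall>y. \<exists>q. Q y \<longrightarrow> length q = F y \<and> Suc (str_code q) = 2 ^ F y + r y"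
    using ex_string_of_length r_bound by blast
  then obtain q where q: "\<And>y. Q y \<Longrightarrow> length (q y) = F y"
      "\<And>y. Q y \<Longrightarrow> Suc (str_code (q y)) = 2 ^ F y + r y" by metis
  define w where "w y = replicate (F y) True @ False # q y" for y
  have w: "str_code (w y) = P y" if "Q y" for y
  proof -
    have "str_code (False # q y) + 2 = 2 * (2 ^ F y + r y) + 1"
      using q(2)[OF that] by simp
    then show ?thesis
      using str_code_replicate_True[of "F y" "False # q y"] unfolding w_def P_def
      by (metis add_diff_cancel_right')
  qed
  have w_prefix: "y = y'" if "Q y" "Q y'" "prefix (w y) (w y')" for y y'
  proof -
    have F: "F y = F y'" using that(3) unfolding w_def by (rule prefix_self_delimiting)
    then have "length (q y) = length (q y')" using q(1)[OF that(1)] q(1)[OF that(2)] by simp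
    then have "w y = w y'" using that(3) F unfolding w_def by (auto simp: prefix_def)
    then have "q y = q y'" using F unfolding w_def by simp
    then have "r y = r y'" using q(2)[OF that(1)] q(2)[OF that(2)] F by simp
    then show "y = y'" using r_mono[of y y'] r_mono[of y' y] that F by (metis less_irrefl linorder_neqE_nat)
  qed
  have w_inj: "y = y'" if "Q y" "Q y'" "P y = P y'" for y y'
  proof -
    have "str_code (w y) = str_code (w y')"
      using w[OF that(1)] w[OF that(2)] that(3) by simp
    then show ?thesis using w_prefix[OF that(1,2)] by simp
  qed
  define f where "f x = (if \<exists>y. Q y \<and> P y = x then Some (LEAST y. Q y \<and> P y = x) else None)" for x
  define M where "M p = map_option decode (f (str_code p))" for p
  have f: "f (P y) = Some y" if "Q y" for y
  proof -
    have "(LEAST z. Q z \<and> P z = P y) = y"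
      by (rule Least_equality) (use that w_inj in auto)
    then show ?thesis unfolding f_def using that by auto
  qed
  have "computable1 (\<lambda>x. of_bool (Q x))" "computable1 F"
    using H G unfolding Q_def F_def by simp_all
  note comp = recursive_in_comp1[OF this(1)] recursive_in_comp1[OF this(2)] recursive_in_count[OF this]
  have "recursive_in 2 (\<lambda>e. of_bool (\<not> (Q (e 0) \<and> P (e 0) = e 1)))"
    unfolding P_def r_def by (intro rec_intro comp; simp)
  then have "computable2 (\<lambda>y x. of_bool (\<not> (Q y \<and> P y = x)))" 
    by (rule recursive_in_2[of "\<lambda>y x. of_bool (\<not> (Q y \<and> P y = x))", THEN iffD1])
  then obtain c where c: "\<And>y x. eval c [y, x] = Some (of_bool (\<not> (Q y \<and> P y = x)))"
    unfolding computable2_def by blast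
  have "eval (Mu c) [x] = f x" for x by (simp add: c f_def)
  then have "partial_computable f" unfolding partial_computable_def by blast
  moreover have "f (str_code p) = map_option str_code (M p)" for p
    unfolding M_def by (simp add: option.map_comp comp_def option.map_ident)
  moreover have dom: "\<exists>y. Q y \<and> p = w y" if p: "p \<in> dom M" for p
  proof -
    obtain y where "Q y" "P y = str_code p"
      using p unfolding M_def f_def by (auto split: if_splits)
    then have "str_code p = str_code (w y)" using w by simp
    with \<open>Q y\<close> show ?thesis by auto
  qed
  have "p = p'" if "p \<in> dom M" "p' \<in> dom M" "prefix p p'" for p p'
    using dom[OF that(1)] dom[OF that(2)] that(3) w_prefix by auto
  ultimately have "prefix_free_machine M" unfolding prefix_free_machine_def by blast
  then obtain c where c: "\<And>s. KM U s \<le> KM M s + enat c"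
    using U unfolding universal_machine_def by blast
  have "KM U s \<le> enat (2 * G s + (c + 1))" if "H s" for s
  proof -
    have Q: "Q (str_code s)" unfolding Q_def using that by simp
    have "M (w (str_code s)) = Some s" unfolding M_def w[OF Q] f[OF Q] by simp
    then have "KM M s \<le> enat (length (w (str_code s)))"
      unfolding KM_def by (intro INF_lower) simp
    also have "length (w (str_code s)) = 2 * G s + 1"
      unfolding w_def using q(1)[OF Q] by (simp add: F_def)
    finally have "KM M s + enat c \<le> enat (2 * G s + 1) + enat c" by (rule add_right_mono)
    with c[of s] show ?thesis by (simp add: order_trans ac_simps)
  qed
  then show ?thesis by blast
qed

section \<open>Cantor space and fair coin tosses\<close>

lemma length_init [simp]: "length (init X n) = n"
  by (simp add: init_def)

lemma take_init: "i \<le> n \<Longrightarrow> take i (init X n) = init X i"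
  by (simp add: init_def take_map)

lemma mem_cyl_iff: "X \<in> cyl s \<longleftrightarrow> (\<forall>i<length s. X i = s ! i)"
proof -
  have "init X (length s) ! i = X i" if "i < length s" for i using that by (simp add: init_def)
  then show ?thesis unfolding cyl_def by (auto intro: nth_equalityI)
qed

lemma mem_cyl_init: "X \<in> cyl (init X n)"
  by (simp add: cyl_def)

text \<open>
  On a countable product the Borel sets form the product \<sigma>-algebra because the factors are second
  countable; \<open>sets_PiM_equal_borel\<close> requires this property as a class instance.
\<close>

instance bool :: second_countable_topology
proof
  show "\<exists>B :: bool set set. countable B \<and> open = generate_topology B"
  proof (intro exI conjI)
    show "open = generate_topology (UNIV :: bool set set)"
      by (auto simp: fun_eq_iff open_discrete intro: generate_topology.Basis)
  qed simp
qed

lemma sets_borel_cantor: "sets (borel :: cantor measure) = sets (PiM UNIV (\<lambda>_. borel))"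
  by (rule sets_PiM_equal_borel[symmetric])

lemma sets_borel_bool: "sets (borel :: bool measure) = UNIV"
  by (simp add: sets_borel_eq_count_space)

lemma measurable_coord [measurable]: "(\<lambda>X::cantor. X i) \<in> borel \<rightarrow>\<^sub>M count_space UNIV"
proof -
  have "(\<lambda>X. X i) \<in> PiM UNIV (\<lambda>_. borel) \<rightarrow>\<^sub>M (borel :: bool measure)"
    by (rule measurable_component_singleton) simp
  then show ?thesis
    by (subst measurable_cong_sets[OF sets_borel_cantor, of _ "borel :: bool measure"])
      (simp_all add: sets_borel_bool)
qed

lemma sets_cyl [measurable]: "cyl s \<in> sets borel"
proof -
  have "cyl s = {X \<in> space borel. \<forall>i\<in>{..<length s}. X i = s ! i}"
    by (auto simp: mem_cyl_iff)
  also have "\<dots> \<in> sets borel" by measurable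
  finally show ?thesis .
qed

lemma measurable_init [measurable]: "(\<lambda>X. init X n) \<in> borel \<rightarrow>\<^sub>M count_space UNIV"
proof (rule measurable_count_space_eq2_countable[THEN iffD2], intro conjI ballI)
  fix s :: "bool list"
  have "(\<lambda>X. init X n) -` {s} \<inter> space borel = (if length s = n then cyl s else {})"
  proof (cases "length s = n")
    case True
    then show ?thesis by (simp add: cyl_def vimage_def)
  qed auto
  then show "(\<lambda>X. init X n) -` {s} \<inter> space borel \<in> sets borel" by simp
qed simp

definition coins :: "cantor measure" where
  "coins = PiM UNIV (\<lambda>_. uniform_count_measure UNIV)"

lemma sets_coins: "sets coins = sets borel"
  unfolding coins_def sets_borel_cantor
  by (intro sets_PiM_cong) (simp_all add: sets_borel_bool sets_uniform_count_measure)

lemma space_coins: "space coins = UNIV"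
  using sets_eq_imp_space_eq[OF sets_coins] by simp

lemma prob_space_coins: "prob_space coins"
  unfolding coins_def
  by (intro prob_space_PiM prob_space_uniform_count_measure) simp_all

lemma measure_coins:
  assumes "finite J"
  shows "measure coins {Z. \<forall>i\<in>J. Z i = z i} = 1 / 2 ^ card J"
proof -
  interpret product_prob_space "\<lambda>_. uniform_count_measure (UNIV :: bool set)" UNIV
    by (simp add: product_prob_space_def product_prob_space_axioms_def product_sigma_finite_def
        prob_space_uniform_count_measure prob_space_imp_sigma_finite)
  have "{Z. \<forall>i\<in>J. Z i = z i} = prod_emb UNIV (\<lambda>_. uniform_count_measure UNIV) J (\<Pi>\<^sub>E i\<in>J. {z i})"
    by (auto simp: prod_emb_def space_uniform_count_measure PiE_iff restrict_def)
  then have "measure coins {Z. \<forall>i\<in>J. Z i = z i} = (\<Prod>i\<in>J. measure (uniform_count_measure UNIV) {z i})"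
    unfolding coins_def using assms by (simp add: measure_PiM_emb sets_uniform_count_measure)
  also have "\<dots> = 1 / 2 ^ card J"
    by (simp add: measure_uniform_count_measure power_one_over)
  finally show ?thesis .
qed

text \<open>
  Cylinders of distinct strings of the same length are disjoint, so their measures add up to at most \<open>1\<close>.
\<close>

lemma few_heavy_strings:
  assumes \<mu>: "cantor_measure \<mu>" and S: "\<And>s. s \<in> S \<Longrightarrow> length s = n \<and> \<epsilon> \<le> measure \<mu> (cyl s)"
  shows "finite S \<and> real (card S) * \<epsilon> \<le> 1"
proof
  interpret prob_space \<mu> using \<mu> by (simp add: cantor_measure_def)
  have "S \<subseteq> {s. set s \<subseteq> UNIV \<and> length s = n}" using S by auto
  then show fin: "finite S" by (rule finite_subset) (rule finite_lists_length_eq, simp)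
  have "real (card S) * \<epsilon> \<le> (\<Sum>s\<in>S. measure \<mu> (cyl s))"
    using S sum_mono[of S "\<lambda>_. \<epsilon>"] by simp
  also have "\<dots> = measure \<mu> (\<Union>s\<in>S. cyl s)"
  proof (rule finite_measure_finite_Union[symmetric])
    show "disjoint_family_on cyl S"
      using S unfolding disjoint_family_on_def cyl_def by auto
    have "events = sets borel" using \<mu> by (simp add: cantor_measure_def)
    then show "cyl ` S \<subseteq> events" using sets_cyl by blast
  qed (rule fin)
  also have "\<dots> \<le> 1" by simp
  finally show "real (card S) * \<epsilon> \<le> 1" .
qed


section \<open>Replacing the tail of a random sequence by coin tosses\<close>

text \<open>
  The bits of \<open>Y\<close> are used as long as the prefix read so far does not satisfy \<open>stop\<close>. Asking only about the
  prefix of \<open>Y\<close>, rather than of the sequence produced, gives the same result for a \<open>stop\<close> that persists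
  under extension, and makes each bit an explicit function of \<open>Y\<close> and \<open>Z\<close>.
\<close>

definition splice :: "(bool list \<Rightarrow> bool) \<Rightarrow> cantor \<Rightarrow> cantor \<Rightarrow> cantor" where
  "splice stop Y Z n = (if stop (init Y n) then Z n else Y n)"

definition spliced :: "(bool list \<Rightarrow> bool) \<Rightarrow> cantor measure \<Rightarrow> cantor measure" where
  "spliced stop \<mu> = distr (\<mu> \<Otimes>\<^sub>M coins) borel (\<lambda>(Y, Z). splice stop Y Z)"

text \<open>
  For a persistent \<open>stop\<close>, this is the number of leading bits of \<open>s\<close> that come from \<open>\<mu>\<close> and not from a
  coin toss. Counting makes it a bounded sum, hence recursive for a decidable \<open>stop\<close>.
\<close>

definition live :: "(bool list \<Rightarrow> bool) \<Rightarrow> bool list \<Rightarrow> nat" where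
  "live stop s = card {i. i < length s \<and> \<not> stop (take i s)}"

locale stopped_measure =
  fixes \<mu> :: "cantor measure" and stop :: "bool list \<Rightarrow> bool"
  assumes cantor_measure: "cantor_measure \<mu>"
    and stop_append: "stop s \<Longrightarrow> stop (s @ t)"
begin

sublocale prob_space \<mu> using cantor_measure by (simp add: cantor_measure_def)

lemma sets_\<mu>: "sets \<mu> = sets borel" using cantor_measure by (simp add: cantor_measure_def)

lemma space_\<mu>: "space \<mu> = UNIV" using sets_eq_imp_space_eq[OF sets_\<mu>] by simp

sublocale C: prob_space coins by (rule prob_space_coins)
sublocale P: pair_prob_space \<mu> coins by unfold_locales

lemma stop_take_mono: "i \<le> j \<Longrightarrow> stop (take i s) \<Longrightarrow> stop (take j s)"
  using stop_append[of "take i s" "drop i (take j s)"]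
  by (metis append_take_drop_id min.absorb1 take_take)

lemma stop_init_mono: "i \<le> j \<Longrightarrow> stop (init X i) \<Longrightarrow> stop (init X j)"
  using stop_take_mono[of i j "init X j"] by (simp add: take_init)

lemma live_le: "live stop s \<le> length s"
  unfolding live_def using card_mono[of "{..<length s}" "{i. i < length s \<and> \<not> stop (take i s)}"] by auto

lemma live_iff:
  assumes "i < length s" shows "i < live stop s \<longleftrightarrow> \<not> stop (take i s)"
proof -
  define m where "m = (LEAST i. i = length s \<or> stop (take i s))"
  have m: "m = length s \<or> stop (take m s)" unfolding m_def by (rule LeastI_ex) blast
  have m_le: "m \<le> length s" unfolding m_def by (rule Least_le) simp
  have before: "\<not> stop (take j s)" if "j < m" for j
    using not_less_Least[of j "\<lambda>i. i = length s \<or> stop (take i s)"] that unfolding m_def by simp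
  have after: "stop (take j s)" if "m \<le> j" "j < length s" for j
    using m that stop_take_mono[of m j s] by auto
  have "{i. i < length s \<and> \<not> stop (take i s)} = {..<m}"
    using before after m_le by (auto simp: not_le[symmetric])
  then have "live stop s = m" unfolding live_def by simp
  then show ?thesis using before after assms by (meson not_le)
qed

lemma measurable_splice [measurable]:
  "(\<lambda>(Y, Z). splice stop Y Z) \<in> \<mu> \<Otimes>\<^sub>M coins \<rightarrow>\<^sub>M borel"
proof -
  have [measurable_cong]: "sets \<mu> = sets borel" "sets coins = sets borel"
    by (fact sets_\<mu> sets_coins)+
  have "(\<lambda>p n. if stop (init (fst p) n) then snd p n else fst p n)
      \<in> \<mu> \<Otimes>\<^sub>M coins \<rightarrow>\<^sub>M PiM UNIV (\<lambda>_. count_space UNIV :: bool measure)"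
    by (intro measurable_PiM_single') (auto simp: space_PiM)
  moreover have "sets (PiM UNIV (\<lambda>_. count_space UNIV :: bool measure)) = sets (borel :: cantor measure)"
    unfolding sets_borel_cantor by (intro sets_PiM_cong) (simp_all add: sets_borel_bool)
  ultimately show ?thesis
    by (simp add: splice_def[abs_def] case_prod_beta' cong: measurable_cong_sets)
qed

lemma cantor_measure_spliced: "cantor_measure (spliced stop \<mu>)"
  unfolding cantor_measure_def spliced_def
  using P.prob_space_distr[OF measurable_splice] by simp

text \<open>
  The condition that the spliced sequence starts with \<open>s\<close> is a product event: \<open>Y\<close> is responsible for the
  live bits of \<open>s\<close> and \<open>Z\<close> for the others. The point is that \<open>Y\<close> may differ from \<open>s\<close> after the live
  bits without affecting where the splicing happens.
\<close>

lemma splice_mem_cyl_iff: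
  "splice stop Y Z \<in> cyl s \<longleftrightarrow>
    Y \<in> cyl (take (live stop s) s) \<and> (\<forall>i\<in>{live stop s..<length s}. Z i = s ! i)"
proof -
  let ?m = "live stop s"
  have Y_init: "init Y i = take i s" if "Y \<in> cyl (take ?m s)" "i \<le> ?m" for i
  proof -
    have "init Y ?m = take ?m s" using that(1) live_le[of s] by (simp add: cyl_def min_absorb2)
    then show ?thesis using that(2) take_init[of i ?m Y] by (simp add: min_absorb1)
  qed
  have bit: "splice stop Y Z i = (if i < ?m then Y i else Z i)"
    if Y: "Y \<in> cyl (take ?m s)" and i: "i < length s" for i
  proof (cases "i < ?m")
    case True
    then show ?thesis using Y_init[OF Y, of i] live_iff[OF i] by (simp add: splice_def)
  next
    case False
    then have "stop (take ?m s)" using live_iff[of ?m s] i by simp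
    then have "stop (init Y i)" using Y_init[OF Y, of ?m] stop_init_mono[of ?m i Y] False by simp
    then show ?thesis using False by (simp add: splice_def)
  qed
  have Y: "Y \<in> cyl (take ?m s)" if s: "splice stop Y Z \<in> cyl s"
  proof -
    have "init Y i = take i s" if "i \<le> ?m" for i
      using that
    proof (induction i)
      case (Suc i)
      then have i: "i < length s" using live_le[of s] by simp
      have "\<not> stop (init Y i)" using Suc live_iff[OF i] by simp
      then have "Y i = s ! i" using s i by (auto simp: mem_cyl_iff splice_def)
      then show ?case using Suc i by (simp add: init_def take_Suc_conv_app_nth)
    qed (simp add: init_def)
    then show ?thesis by (simp add: cyl_def live_le min_absorb2)
  qed
  show ?thesis
  proof
    assume s: "splice stop Y Z \<in> cyl s"
    then show "Y \<in> cyl (take ?m s) \<and> (\<forall>i\<in>{?m..<length s}. Z i = s ! i)"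
      using Y[OF s] bit[OF Y[OF s]] by (auto simp: mem_cyl_iff[of _ s])
  next
    assume a: "Y \<in> cyl (take ?m s) \<and> (\<forall>i\<in>{?m..<length s}. Z i = s ! i)"
    then show "splice stop Y Z \<in> cyl s"
      using bit by (auto simp: mem_cyl_iff)
  qed
qed

lemma measure_Times_coins: "A \<in> sets \<mu> \<Longrightarrow> B \<in> sets coins \<Longrightarrow>
    measure (\<mu> \<Otimes>\<^sub>M coins) (A \<times> B) = measure \<mu> A * measure coins B"
  by (simp add: measure_def C.emeasure_pair_measure_Times enn2real_mult)

lemma measure_spliced: "A \<in> sets borel \<Longrightarrow>
    measure (spliced stop \<mu>) A = measure (\<mu> \<Otimes>\<^sub>M coins) {(Y, Z). splice stop Y Z \<in> A}"
  unfolding spliced_def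
  by (subst measure_distr[OF measurable_splice])
    (auto simp: space_pair_measure space_\<mu> space_coins intro!: arg_cong[where f = "measure _"])

lemma measure_spliced_cyl:
  "measure (spliced stop \<mu>) (cyl s) =
    measure \<mu> (cyl (take (live stop s) s)) / 2 ^ (length s - live stop s)"
proof -
  let ?m = "live stop s"
  let ?B = "{Z :: cantor. \<forall>i\<in>{?m..<length s}. Z i = s ! i}"
  have "?B = {Z \<in> space borel. \<forall>i\<in>{?m..<length s}. Z i = s ! i}" by simp
  also have "\<dots> \<in> sets borel" by measurable
  finally have B: "?B \<in> sets coins" unfolding sets_coins .
  have "{(Y, Z). splice stop Y Z \<in> cyl s} = cyl (take ?m s) \<times> ?B"
    unfolding splice_mem_cyl_iff by auto
  then show ?thesis
    using B by (simp add: measure_spliced measure_Times_coins sets_\<mu> measure_coins)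
qed

text \<open>
  A sequence that is stopped at \<open>n\<close> gains a factor \<open>1/2\<close> with each further bit; the other sequences are
  covered by the hypothesis, since \<open>\<mu>\<close> and the spliced measure agree on their prefixes.
\<close>

lemma continuous_spliced:
  assumes small: "\<And>Y \<epsilon>. \<forall>n. \<not> stop (init Y n) \<Longrightarrow> 0 < \<epsilon> \<Longrightarrow> \<exists>n. measure \<mu> (cyl (init Y n)) < \<epsilon>"
  shows "continuous_measure (spliced stop \<mu>)"
  unfolding continuous_measure_def
proof
  fix Y
  interpret S: prob_space "spliced stop \<mu>"
    using cantor_measure_spliced by (simp add: cantor_measure_def)
  have sets: "sets (spliced stop \<mu>) = sets borel" by (simp add: spliced_def)
  have le: "measure (spliced stop \<mu>) {Y} \<le> measure (spliced stop \<mu>) (cyl (init Y n))" for n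
    by (intro S.finite_measure_mono) (auto simp: sets mem_cyl_init)
  have "measure (spliced stop \<mu>) {Y} \<le> \<epsilon>" if \<epsilon>: "0 < \<epsilon>" for \<epsilon>
  proof (cases "\<exists>n. stop (init Y n)")
    case True
    then obtain n where n: "stop (init Y n)" by blast
    obtain k where k: "(1/2) ^ k < \<epsilon>" using \<epsilon> real_arch_pow_inv[of \<epsilon> "1/2"] by auto
    let ?s = "init Y (Suc (n + k))"
    have "live stop ?s \<le> n" using live_iff[of n ?s] n by (simp add: take_init not_less[symmetric])
    then have "(1/2::real) ^ (Suc (n + k) - live stop ?s) \<le> (1/2) ^ k"
      by (intro power_decreasing) auto
    moreover have "measure (spliced stop \<mu>) (cyl ?s) \<le> 1 / 2 ^ (Suc (n + k) - live stop ?s)"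
      unfolding measure_spliced_cyl by (simp add: divide_right_mono)
    ultimately show ?thesis using le[of "Suc (n + k)"] k by (simp add: power_one_over)
  next
    case False
    then obtain n where "measure \<mu> (cyl (init Y n)) < \<epsilon>" using small[OF _ \<epsilon>] by blast
    moreover have "live stop (init Y n) = n"
      using False by (simp add: live_def take_init cong: conj_cong)
    then have "measure (spliced stop \<mu>) (cyl (init Y n)) = measure \<mu> (cyl (init Y n))"
      by (simp add: measure_spliced_cyl take_init)
    ultimately show ?thesis using le[of n] by simp
  qed
  then show "measure (spliced stop \<mu>) {Y} = 0"
    by (meson field_le_epsilon measure_nonneg antisym dense_ge)
qed

text \<open>
  From a test for the spliced measure keep only the cylinders \<open>cyl s\<close> with \<open>\<not> stop s\<close>. A sequence \<open>Y\<close> in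
  such a cylinder is not altered within \<open>s\<close>, whatever the coins \<open>Z\<close> are, so the result of splicing still
  belongs to the original open set. Thus the \<open>\<mu>\<close>-measure of the restricted set is at most the spliced
  measure of the original one. No cylinder around \<open>X\<close> is lost because no prefix of \<open>X\<close> is stopped.
\<close>

lemma ml_random_spliced:
  assumes stop: "computable1 (\<lambda>x. of_bool (stop (decode x)))"
    and X: "ml_random \<mu> X" "\<And>n. \<not> stop (init X n)"
  shows "ml_random (spliced stop \<mu>) X"
  unfolding ml_random_def
proof (intro allI impI)
  fix U assume "ml_test (spliced stop \<mu>) U"
  then obtain R where R: "decidable3 R" and U: "\<And>i. U i = (\<Union>s\<in>{s. \<exists>k. R i (str_code s) k}. cyl s)"
    and U_small: "\<And>i. measure (spliced stop \<mu>) (U i) \<le> 1 / 2 ^ i"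
    unfolding ml_test_def uniformly_Sigma01_def by blast
  define R' where "R' i x k \<longleftrightarrow> R i x k \<and> \<not> stop (decode x)" for i x k
  define V where "V i = (\<Union>s\<in>{s. \<exists>k. R' i (str_code s) k}. cyl s)" for i
  have "recursive_in 3 (\<lambda>e. of_bool (R' (e 0) (e 1) (e 2)))"
    unfolding R'_def by (intro rec_intro recursive_in_comp3[OF R] recursive_in_comp1[OF stop]; simp)
  then have "uniformly_Sigma01 V"
    unfolding uniformly_Sigma01_def V_def recursive_in_3 by blast
  moreover have "measure \<mu> (V i) \<le> 1 / 2 ^ i" for i
  proof -
    have sets: "U i \<in> sets borel" "V i \<in> sets \<mu>" unfolding U V_def sets_\<mu> by auto
    have "measure \<mu> (V i) = measure (\<mu> \<Otimes>\<^sub>M coins) (V i \<times> space coins)"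
      using sets by (simp add: measure_Times_coins C.prob_space)
    also have "\<dots> \<le> measure (\<mu> \<Otimes>\<^sub>M coins) {(Y, Z). splice stop Y Z \<in> U i}"
    proof (rule P.finite_measure_mono)
      show "V i \<times> space coins \<subseteq> {(Y, Z). splice stop Y Z \<in> U i}"
      proof clarify
        fix Y Z assume "Y \<in> V i"
        then obtain s k where s: "R i (str_code s) k" "\<not> stop s" "Y \<in> cyl s"
          unfolding V_def R'_def by auto
        have "\<not> stop (init Y j)" if "j < length s" for j
          using stop_init_mono[of j "length s" Y] s that by (auto simp: cyl_def)
        then have "splice stop Y Z \<in> cyl s" using s by (simp add: mem_cyl_iff splice_def)
        then show "splice stop Y Z \<in> U i" unfolding U using s by blast
      qed
      have "(\<lambda>(Y, Z). splice stop Y Z) -` U i \<inter> space (\<mu> \<Otimes>\<^sub>M coins) \<in> sets (\<mu> \<Otimes>\<^sub>M coins)"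
        using measurable_splice sets(1) by (rule measurable_sets)
      then show "{(Y, Z). splice stop Y Z \<in> U i} \<in> sets (\<mu> \<Otimes>\<^sub>M coins)"
        by (simp add: space_pair_measure space_\<mu> space_coins vimage_def case_prod_beta')
    qed
    also have "\<dots> = measure (spliced stop \<mu>) (U i)" using measure_spliced[OF sets(1)] by simp
    finally show ?thesis using U_small[of i] by simp
  qed
  ultimately have "ml_test \<mu> V" unfolding ml_test_def by blast
  then obtain i where i: "X \<notin> V i" using X(1) unfolding ml_random_def by blast
  have "X \<in> V i" if Xi: "X \<in> U i"
  proof -
    obtain s k where s: "R i (str_code s) k" "X \<in> cyl s" using Xi unfolding U by blast
    then have "\<not> stop s" using X(2)[of "length s"] by (simp add: cyl_def)
    then show ?thesis unfolding V_def R'_def using s by auto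
  qed
  then show "X \<notin> (\<Inter>i. U i)" using i by blast
qed

lemma recursive_in_stop:
  assumes "computable1 (\<lambda>x. of_bool (stop (decode x)))" "recursive_in n A" "recursive_in n B"
  shows "recursive_in n (\<lambda>e. of_bool (stop (take (A e) (decode (B e)))))"
  using recursive_in_comp1[OF assms(1) recursive_in_take[OF assms(2,3)]] by simp

text \<open>
  A value of the spliced measure is a value of \<open>\<mu>\<close> divided by a power of two. Dividing a rational
  approximation by this power, that is, multiplying its denominator, does not increase the error.
\<close>

lemma computable_spliced:
  assumes stop: "computable1 (\<lambda>x. of_bool (stop (decode x)))"
    and comp: "computable_measure \<mu>"
  shows "computable_measure (spliced stop \<mu>)"
proof -
  obtain a b d where c: "computable2 a" "computable2 b" "computable2 d"
    and approx: "\<And>s n. \<bar>measure \<mu> (cyl s) - (real (a (str_code s) n) - real (b (str_code s) n))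
      / real (Suc (d (str_code s) n))\<bar> \<le> 1 / 2 ^ n"
    using comp unfolding computable_measure_def computable_real_fun_def by blast
  define m where "m x = live stop (decode x)" for x
  define t where "t x = str_code (take (m x) (decode x))" for x
  define d' where "d' x n = 2 ^ (length (decode x) - m x) * Suc (d (t x) n) - 1" for x n
  have m_sum: "m x = (\<Sum>i<length (decode x). of_bool (\<not> stop (take i (decode x))))" for x
    unfolding m_def live_def by (simp add: lessThan_def Collect_conj_eq[symmetric])
  have m_rec: "recursive_in n (\<lambda>e. m (A e))" if "recursive_in n A" for n A
    unfolding m_sum
    by (intro rec_intro recursive_in_stop[OF stop] that that[THEN recursive_in_weaken]; simp)
  have t_rec: "recursive_in n (\<lambda>e. t (A e))" if "recursive_in n A" for n A
    unfolding t_def by (intro rec_intro m_rec that)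
  note rec = rec_intro m_rec t_rec c[THEN recursive_in_comp2]
  have "computable2 (\<lambda>x n. a (t x) n)" "computable2 (\<lambda>x n. b (t x) n)" "computable2 d'"
    unfolding d'_def[abs_def] recursive_in_2[symmetric] by (intro rec; simp)+
  moreover have "\<bar>measure (spliced stop \<mu>) (cyl s) - (real (a (t (str_code s)) n) - real (b (t (str_code s)) n))
      / real (Suc (d' (str_code s) n))\<bar> \<le> 1 / 2 ^ n" for s n
  proof -
    define N where "N = length s - live stop s"
    let ?t = "take (live stop s) s"
    have t: "t (str_code s) = str_code ?t" unfolding t_def m_def by simp
    have "Suc (d' (str_code s) n) = 2 ^ N * Suc (d (str_code ?t) n)"
      unfolding d'_def t by (simp add: m_def N_def)
    then have d': "real (Suc (d' (str_code s) n)) = 2 ^ N * real (Suc (d (str_code ?t) n))"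
      by (simp only: of_nat_mult of_nat_power of_nat_numeral)
    have "measure (spliced stop \<mu>) (cyl s) - (real (a (t (str_code s)) n) - real (b (t (str_code s)) n))
        / real (Suc (d' (str_code s) n))
      = (measure \<mu> (cyl ?t) - (real (a (str_code ?t) n) - real (b (str_code ?t) n))
        / real (Suc (d (str_code ?t) n))) / 2 ^ N"
      unfolding measure_spliced_cyl d' t N_def[symmetric] by (simp add: diff_divide_distrib mult.commute)
    moreover have "\<bar>x / 2 ^ N\<bar> = \<bar>x\<bar> / 2 ^ N" for x :: real by simp
    ultimately have "\<bar>measure (spliced stop \<mu>) (cyl s) - (real (a (t (str_code s)) n) - real (b (t (str_code s)) n))
        / real (Suc (d' (str_code s) n))\<bar> \<le> (1 / 2 ^ n) / 2 ^ N"
      using divide_right_mono[OF approx[of ?t n], of "2 ^ N"] by (simp only:) simp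
    also have "\<dots> \<le> 1 / 2 ^ n" by (simp add: divide_le_eq_1 field_simps)
    finally show ?thesis .
  qed
  ultimately show ?thesis
    unfolding computable_measure_def computable_real_fun_def using cantor_measure_spliced by blast
qed

end

section \<open>Continuous measures for complex proper sequences\<close>

theorem theorem3p4:
  fixes U :: machine and X :: cantor
  assumes "universal_machine U"
    and "complex_seq U X"
    and "proper_seq X"
  shows "\<exists>\<nu>. computable_measure \<nu> \<and> continuous_measure \<nu> \<and> ml_random \<nu> X"
proof -
  obtain f where f: "computable1 f" "\<And>m. \<exists>n. m \<le> f n" "\<And>n. enat (f n) \<le> KM U (init X n)"
    using assms(2) unfolding complex_seq_def order_fun_def by blast
  obtain \<mu> where \<mu>: "computable_measure \<mu>" "ml_random \<mu> X"
    using assms(3) unfolding proper_seq_def by blast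
  then have cantor: "cantor_measure \<mu>" unfolding computable_measure_def by blast
  obtain a b d where c: "computable2 a" "computable2 b" "computable2 d"
    and approx: "\<And>s n. \<bar>measure \<mu> (cyl s) - (real (a (str_code s) n) - real (b (str_code s) n))
      / real (Suc (d (str_code s) n))\<bar> \<le> 1 / 2 ^ n"
    using \<mu>(1) unfolding computable_measure_def computable_real_fun_def by blast
  define g where "g n = f n div 3" for n
  have g_rec: "recursive_in n (\<lambda>e. g (A e))" if "recursive_in n A" for n A
    unfolding g_def by (intro rec_intro recursive_in_comp1[OF f(1)] that)
  \<comment> \<open>Only lengths at which \<open>g\<close> reaches a new maximum are considered, so that the value of \<open>g\<close>
    determines the length.\<close>
  define peak where "peak n \<longleftrightarrow> \<not> (\<exists>m<n. g n \<le> g m)" for n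
  \<comment> \<open>The approximation with error \<open>1 / 2 ^ k\<close> exceeds \<open>2 / 2 ^ k\<close>; denominators are cleared.\<close>
  define big where "big x k \<longleftrightarrow> 2 * Suc (d x k) + 2 ^ k * b x k < 2 ^ k * a x k" for x k
  define heavy where
    "heavy s \<longleftrightarrow> peak (length s) \<and> big (str_code s) (g (length s))" for s
  have big_iff: "big (str_code s) k \<longleftrightarrow>
      2 / 2 ^ k < (real (a (str_code s) k) - real (b (str_code s) k)) / real (Suc (d (str_code s) k))" for s k
  proof -
    have "big (str_code s) k \<longleftrightarrow> 2 * real (Suc (d (str_code s) k)) + 2 ^ k * real (b (str_code s) k)
        < 2 ^ k * real (a (str_code s) k)"
      unfolding big_def of_nat_less_iff[where ?'a = real, symmetric]
      by (simp only: of_nat_add of_nat_mult of_nat_power of_nat_numeral)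
    also have "\<dots> \<longleftrightarrow> 2 / 2 ^ k < (real (a (str_code s) k) - real (b (str_code s) k)) / real (Suc (d (str_code s) k))"
      by (simp add: field_simps del: of_nat_Suc)
    finally show ?thesis .
  qed
  have big: "1 / 2 ^ k \<le> measure \<mu> (cyl s)" if "big (str_code s) k" for s k
    using approx[of s k] that[unfolded big_iff] by simp
  have not_big: "measure \<mu> (cyl s) \<le> 3 / 2 ^ k" if "\<not> big (str_code s) k" for s k
    using approx[of s k] that[unfolded big_iff] by simp
  have heavy_rec: "recursive_in n (\<lambda>e. of_bool (heavy (decode (A e))))" if "recursive_in n A" for n A
    unfolding heavy_def peak_def big_def str_code_decode
    by (intro rec_intro c[THEN recursive_in_comp2] g_rec that that[THEN recursive_in_weaken]; simp)
  have few: "finite {s. heavy s \<and> g (length s) = k}" "card {s. heavy s \<and> g (length s) = k} \<le> 2 ^ k" for k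
  proof -
    let ?S = "{s. heavy s \<and> g (length s) = k}"
    have "length s = length t" if "s \<in> ?S" "t \<in> ?S" for s t
      using that unfolding heavy_def peak_def by (metis (mono_tags, lifting) linorder_neqE_nat mem_Collect_eq order_refl)
    then obtain n where "\<And>s. s \<in> ?S \<Longrightarrow> length s = n" by metis
    then have *: "finite ?S \<and> real (card ?S) * (1 / 2 ^ k) \<le> 1"
      using big by (intro few_heavy_strings[OF cantor, where n = n]) (auto simp: heavy_def)
    then show "finite ?S" by blast
    have "real (card ?S) \<le> real (2 ^ k)" using * by (simp add: divide_le_eq_1)
    then show "card ?S \<le> 2 ^ k" by (simp only: of_nat_le_iff)
  qed
  have "computable1 (\<lambda>x. of_bool (heavy (decode x)))" "computable1 (\<lambda>x. g (length (decode x)))"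
    unfolding recursive_in_1[symmetric] by (intro rec_intro heavy_rec g_rec; simp)+
  from KM_le_of_few[OF assms(1) this few]
  obtain c0 where c0: "\<And>s. heavy s \<Longrightarrow> KM U s \<le> enat (2 * g (length s) + c0)" by blast
  have X_light: "g n \<le> c0" if "heavy (init X n)" for n
  proof -
    have "enat (f n) \<le> enat (2 * g n + c0)" using order_trans[OF f(3) c0[OF that]] by simp
    then have "f n \<le> 2 * g n + c0" by simp
    moreover have "3 * g n \<le> f n" unfolding g_def by simp
    ultimately show ?thesis by simp
  qed
  \<comment> \<open>A prefix of \<open>X\<close> can be heavy only where \<open>g\<close> is at most \<open>c0\<close>; stopping is restricted to larger
    values, so \<open>X\<close> is never stopped.\<close>
  define stop where "stop s \<longleftrightarrow> (\<exists>i<Suc (length s). c0 < g i \<and> heavy (take i s))" for s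
  have heavy_take_rec: "recursive_in n (\<lambda>e. of_bool (heavy (take (A e) (decode (B e)))))"
    if "recursive_in n A" "recursive_in n B" for n A B
    using heavy_rec[OF recursive_in_take[OF that]] by simp
  have stop_comp: "computable1 (\<lambda>x. of_bool (stop (decode x)))"
    unfolding recursive_in_1[symmetric] stop_def by (intro rec_intro heavy_take_rec g_rec; simp)
  interpret stopped_measure \<mu> stop
  proof
    show "stop (s @ t)" if s: "stop s" for s t
    proof -
      obtain i where "i < Suc (length s)" "c0 < g i" "heavy (take i s)"
        using s unfolding stop_def by blast
      then show ?thesis unfolding stop_def by (intro exI[of _ i]) simp
    qed
  qed (rule cantor)
  have "continuous_measure (spliced stop \<mu>)"
  proof (rule continuous_spliced)
    fix Y and \<epsilon> :: real assume Y: "\<forall>n. \<not> stop (init Y n)" and "0 < \<epsilon>"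
    then obtain k0 where "(1/2) ^ k0 < \<epsilon> / 3" using real_arch_pow_inv[of "\<epsilon> / 3" "1/2"] by auto
    define k where "k = max k0 (Suc c0)"
    \<comment> \<open>The first length with \<open>k \<le> g n\<close> is a new maximum of \<open>g\<close>, and the prefix of \<open>Y\<close> of this length
      is not heavy since \<open>Y\<close> is not stopped.\<close>
    obtain n' where "3 * k \<le> f n'" using f(2) by blast
    then have "k \<le> g n'" unfolding g_def by simp
    then obtain n where n: "k \<le> g n" "\<And>m. m < n \<Longrightarrow> g m < k"
      using exists_least_iff[of "\<lambda>n. k \<le> g n"] by (auto simp: not_le)
    then have "peak n" unfolding peak_def by (auto simp: not_le intro: less_le_trans)
    moreover have "\<not> heavy (init Y n)"
      using Y[rule_format, of n] n(1) unfolding stop_def k_def by (auto simp: take_init Suc_le_eq)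
    ultimately have "\<not> big (str_code (init Y n)) (g n)" unfolding heavy_def by simp
    then have "measure \<mu> (cyl (init Y n)) \<le> 3 * (1/2) ^ g n"
      using not_big by (simp add: power_one_over)
    also have "\<dots> \<le> 3 * (1/2) ^ k0"
      using n(1) unfolding k_def by (intro mult_left_mono power_decreasing) auto
    also have "\<dots> < \<epsilon>" using \<open>(1/2) ^ k0 < \<epsilon> / 3\<close> by simp
    finally show "\<exists>n. measure \<mu> (cyl (init Y n)) < \<epsilon>" by blast
  qed
  moreover have "\<not> stop (init X n)" for n
    unfolding stop_def by (auto simp: take_init dest: X_light)
  then have "ml_random (spliced stop \<mu>) X" using ml_random_spliced[OF stop_comp \<mu>(2)] by blast
  ultimately show ?thesis using computable_spliced[OF stop_comp \<mu>(1)] by blast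
qed

end
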